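(* Let $H$ be a finite hypergraph, let $\mathfrak{R}$ be an equivalence relation on $V(H)$, and let $T:\mathbb{C}^{V(H)}\to\mathbb{C}^{V(H)}$ be an $\mathfrak{R}$-compatible linear operator. If $\lambda$ is an eigenvalue of the $\mathfrak{R}$-contraction $T_{\mathfrak{R}}$ with eigenvector $y$, then $\lambda$ is an eigenvalue of $T$ with an eigenvector $y_{\mathfrak{R}}$, the $\mathfrak{R}$-blow up of $y$.
   Context: A (finite) hypergraph $H$ is a pair $(V(H),E(H))$, where $V(H)$ is a non-empty finite set and $E(H)$ is a collection of non-empty subsets of $V(H)$. $\mathbb{C}^{X}$ is the vector space of all functions $X\to\mathbb{C}$. For $U\subseteq V(H)$, $\chi_U$ is the characteristic function of $U$. For distinct $u,v\in V(H)$, $\phi_{uv}:V(H)\to V(H)$ is the transposition that interchanges $u$ and $v$ and fixes every other vertex. Given an equivalence relation $\mathfrak{R}$ on $V(H)$, a linear map $T:\mathbb{C}^{V(H)}\to\mathbb{C}^{V(H)}$ is called $\mathfrak{R}$-compatible if for every $\mathfrak{R}$-equivalence class $W$, every pair $\{u,v\}\subseteq W$ and every $x\in\mathbb{C}^{V(H)}$, $(Tx)\circ\phi_{uv}=T(x\circ\phi_{uv})$. Let $\mathfrak{C}_{\mathfrak{R}}=\{W_1,\dots,W_m\}$ be the set of all $\mathfrak{R}$-equivalence classes. If $T$ is $\mathfrak{R}$-compatible, there are constants $c^i_j$ ($i,j=1,\dots,m$) with $T\chi_{W_i}=\sum_{j=1}^m c^i_j\chi_{W_j}$ for all $i$. The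 $\mathfrak{R}$-contraction of $T$ is the linear operator $T_{\mathfrak{R}}:\mathbb{C}^{\mathfrak{C}_{\mathfrak{R}}}\to\mathbb{C}^{\mathfrak{C}_{\mathfrak{R}}}$ given by $(T_{\mathfrak{R}}y)(W_j)=\sum_{i=1}^m c^i_j\,y(W_i)$. For $y:\mathfrak{C}_{\mathfrak{R}}\to\mathbb{C}$, the $\mathfrak{R}$-blow up of $y$ is the function $y_{\mathfrak{R}}:V(H)\to\mathbb{C}$ with $y_{\mathfrak{R}}(v)=y(W_i)$ for all $v\in W_i$, $i=1,\dots,m$. *)

theory Defs
  imports Complex_Main "HOL-Library.FuncSet" "HOL-Library.Indicator_Function"
    "HOL-Combinatorics.Transposition"
begin

type_synonym 'v hypergraph = "'v set \<times> 'v set set"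

abbreviation verts :: "'v hypergraph \<Rightarrow> 'v set" where
  "verts H \<equiv> fst H"

abbreviation edges :: "'v hypergraph \<Rightarrow> 'v set set" where
  "edges H \<equiv> snd H"

definition finite_hypergraph :: "'v hypergraph \<Rightarrow> bool" where
  "finite_hypergraph H \<longleftrightarrow>
     finite (verts H) \<and> verts H \<noteq> {} \<and> (\<forall>e\<in>edges H. e \<noteq> {} \<and> e \<subseteq> verts H)"

text \<open>A function \<open>X \<rightarrow> \<complex>\<close> is represented by its extension by \<open>0\<close> to the whole type. This makes
  the representation unique, and the pointwise vector space operations and the characteristic
  functions of subsets of \<open>X\<close> are those of the ambient function type.\<close>

definition cfun :: "'a set \<Rightarrow> ('a \<Rightarrow> complex) set" where
  "cfun X = {x. \<forall>a. a \<notin> X \<longrightarrow> x a = 0}"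

definition linear_operator :: "'a set \<Rightarrow> (('a \<Rightarrow> complex) \<Rightarrow> ('a \<Rightarrow> complex)) \<Rightarrow> bool" where
  "linear_operator X T \<longleftrightarrow>
     T \<in> cfun X \<rightarrow> cfun X \<and>
     (\<forall>x\<in>cfun X. \<forall>y\<in>cfun X. T (\<lambda>a. x a + y a) = (\<lambda>a. T x a + T y a)) \<and>
     (\<forall>c. \<forall>x\<in>cfun X. T (\<lambda>a. c * x a) = (\<lambda>a. c * T x a))"

definition eigenvector ::
  "'a set \<Rightarrow> (('a \<Rightarrow> complex) \<Rightarrow> ('a \<Rightarrow> complex)) \<Rightarrow> complex \<Rightarrow> ('a \<Rightarrow> complex) \<Rightarrow> bool" where
  "eigenvector X T \<mu> x \<longleftrightarrow> x \<in> cfun X \<and> x \<noteq> (\<lambda>_. 0) \<and> T x = (\<lambda>a. \<mu> * x a)"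

definition eigenvalue ::
  "'a set \<Rightarrow> (('a \<Rightarrow> complex) \<Rightarrow> ('a \<Rightarrow> complex)) \<Rightarrow> complex \<Rightarrow> bool" where
  "eigenvalue X T \<mu> \<longleftrightarrow> (\<exists>x. eigenvector X T \<mu> x)"

definition compatible ::
  "'v set \<Rightarrow> 'v rel \<Rightarrow> (('v \<Rightarrow> complex) \<Rightarrow> ('v \<Rightarrow> complex)) \<Rightarrow> bool" where
  "compatible V R T \<longleftrightarrow> linear_operator V T \<and>
     (\<forall>W\<in>V // R. \<forall>u\<in>W. \<forall>v\<in>W. u \<noteq> v \<longrightarrow>
        (\<forall>x\<in>cfun V. T x \<circ> transpose u v = T (x \<circ> transpose u v)))"

text \<open>\<open>c W U\<close> is the coefficient of \<open>\<chi>\<^sub>U\<close> in the expansion of \<open>T \<chi>\<^sub>W\<close>.\<close>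

definition is_contraction_coeff ::
  "'v set \<Rightarrow> 'v rel \<Rightarrow> (('v \<Rightarrow> complex) \<Rightarrow> ('v \<Rightarrow> complex)) \<Rightarrow>
     ('v set \<Rightarrow> 'v set \<Rightarrow> complex) \<Rightarrow> bool" where
  "is_contraction_coeff V R T c \<longleftrightarrow>
     (\<forall>W\<in>V // R. T (indicator W) = (\<lambda>v. \<Sum>U\<in>V // R. c W U * indicator U v))"

lemma class_indicator_expansion:
  assumes fin: "finite V" and eq: "equiv V R" and v: "v \<in> V"
  shows "(\<Sum>U\<in>V // R. f U * indicator U v) = (f (R `` {v}) :: complex)"
proof -
  have cls: "R `` {v} \<in> V // R" using v by (rule quotientI)
  have mem: "v \<in> U \<longleftrightarrow> U = R `` {v}" if "U \<in> V // R" for U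
    using that cls eq v by (metis equiv_class_self quotient_eqI quotientE equiv_class_eq_iff Image_singleton_iff)
  have "(\<Sum>U\<in>V // R. f U * indicator U v) = (\<Sum>U\<in>V // R. if U = R `` {v} then f U else 0)"
    by (rule sum.cong) (auto simp: indicator_def mem)
  also have "\<dots> = f (R `` {v})"
    using cls finite_quotient[OF fin] eq by (simp add: equiv_type)
  finally show ?thesis .
qed

lemma contraction_coeff_exists:
  assumes fin: "finite V" and eq: "equiv V R" and T: "compatible V R T"
  shows "\<exists>c. is_contraction_coeff V R T c"
proof -
  define c where "c W U = T (indicator W) (SOME v. v \<in> U)" for W U
  have "T (indicator W) v = (\<Sum>U\<in>V // R. c W U * indicator U v)" if W: "W \<in> V // R" for W v
  proof (cases "v \<in> V")
    case False
    have "indicator W \<in> cfun V"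
      using W in_quotient_imp_subset[OF eq W] by (auto simp: cfun_def indicator_def)
    then have "T (indicator W) v = 0"
      using T False by (auto simp: compatible_def linear_operator_def cfun_def)
    moreover have "v \<notin> U" if "U \<in> V // R" for U
      using in_quotient_imp_subset[OF eq that] False by auto
    ultimately show ?thesis by simp
  next
    case True
    let ?U = "R `` {v}"
    define u where "u = (SOME v. v \<in> ?U)"
    have vU: "v \<in> ?U" using eq True by (rule equiv_class_self)
    then have uU: "u \<in> ?U" unfolding u_def by (rule someI)
    have UQ: "?U \<in> V // R" using True by (rule quotientI)
    have WV: "indicator W \<in> cfun V"
      using in_quotient_imp_subset[OF eq W] by (auto simp: cfun_def indicator_def)
    have "u \<in> W \<longleftrightarrow> v \<in> W"
      using quotient_disj[OF eq W UQ] uU vU by auto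
    then have inv: "(indicator W :: _ \<Rightarrow> complex) \<circ> transpose u v = indicator W"
      by (auto simp: fun_eq_iff indicator_def transpose_def)
    have "T (indicator W) u = T (indicator W) v"
    proof (cases "u = v")
      case False
      then have "T (indicator W) \<circ> transpose u v = T (indicator W \<circ> transpose u v)"
        using T UQ uU vU WV unfolding compatible_def by blast
      then have "(T (indicator W) \<circ> transpose u v) v = T (indicator W) v"
        by (simp only: inv)
      then show ?thesis by simp
    qed simp
    then show ?thesis
      using class_indicator_expansion[OF fin eq True, of "c W"] by (simp add: c_def u_def)
  qed
  then show ?thesis by (auto simp: is_contraction_coeff_def fun_eq_iff)
qed

lemma contraction_coeff_unique:
  assumes fin: "finite V" and eq: "equiv V R"
    and c: "is_contraction_coeff V R T c" and d: "is_contraction_coeff V R T d"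
    and W: "W \<in> V // R" and U: "U \<in> V // R"
  shows "c W U = d W U"
proof -
  obtain v where v: "v \<in> V" and Uv: "U = R `` {v}" using U by (rule quotientE)
  have "(\<Sum>U\<in>V // R. c W U * indicator U v) = (\<Sum>U\<in>V // R. d W U * indicator U v)"
    using c d W unfolding is_contraction_coeff_def by metis
  then show ?thesis
    by (simp add: class_indicator_expansion[OF fin eq v] Uv)
qed

definition contraction_coeff ::
  "'v set \<Rightarrow> 'v rel \<Rightarrow> (('v \<Rightarrow> complex) \<Rightarrow> ('v \<Rightarrow> complex)) \<Rightarrow> 'v set \<Rightarrow> 'v set \<Rightarrow> complex" where
  "contraction_coeff V R T = (SOME c. is_contraction_coeff V R T c)"

definition contraction ::
  "'v set \<Rightarrow> 'v rel \<Rightarrow> (('v \<Rightarrow> complex) \<Rightarrow> ('v \<Rightarrow> complex)) \<Rightarrow>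
     ('v set \<Rightarrow> complex) \<Rightarrow> ('v set \<Rightarrow> complex)" where
  "contraction V R T y =
     (\<lambda>U. if U \<in> V // R then \<Sum>W\<in>V // R. contraction_coeff V R T W U * y W else 0)"

definition blow_up :: "'v set \<Rightarrow> 'v rel \<Rightarrow> ('v set \<Rightarrow> complex) \<Rightarrow> ('v \<Rightarrow> complex)" where
  "blow_up V R y = (\<lambda>v. if v \<in> V then y (R `` {v}) else 0)"

end

theory Submission
  imports Defs
begin

text \<open>The blow up is a linear embedding of the functions on the set of classes into the functions
  on the vertices: it sends the characteristic function of the point \<open>W\<close> to \<open>\<chi>\<^sub>W\<close>, and it is
  injective because every class has a vertex in it. The contraction is, by its very coefficients,
  the matrix of \<open>T\<close> restricted to the span of the \<open>\<chi>\<^sub>W\<close>, so the blow up intertwines the two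
  operators: \<open>T y\<^sub>R = (T\<^sub>R y)\<^sub>R\<close> for every \<open>y\<close> (\<open>compatible_blow_up\<close>). An injective linear map that
  intertwines two operators carries eigenvectors to eigenvectors for the same eigenvalue.\<close>

lemma linear_operator_sum:
  assumes T: "linear_operator X T" and "finite I" and "\<And>i. i \<in> I \<Longrightarrow> f i \<in> cfun X"
  shows "T (\<lambda>a. \<Sum>i\<in>I. c i * f i a) = (\<lambda>a. \<Sum>i\<in>I. c i * T (f i) a)"
proof -
  have add: "T (\<lambda>a. x a + z a) = (\<lambda>a. T x a + T z a)" if "x \<in> cfun X" "z \<in> cfun X" for x z
    using T that unfolding linear_operator_def by blast
  have scale: "T (\<lambda>a. k * x a) = (\<lambda>a. k * T x a)" if "x \<in> cfun X" for k x
    using T that unfolding linear_operator_def by blast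
  show ?thesis
    using assms(2,3)
  proof (induction I rule: finite_induct)
    case empty
    show ?case using scale[of "\<lambda>_. 0" 0] by (simp add: cfun_def)
  next
    case (insert j I)
    have "(\<lambda>a. c j * f j a) \<in> cfun X" "(\<lambda>a. \<Sum>i\<in>I. c i * f i a) \<in> cfun X"
      using insert.prems by (auto simp: cfun_def)
    from add[OF this] show ?case
      using insert by (simp add: scale)
  qed
qed

lemma indicator_class_in_cfun:
  assumes "equiv V R" and "W \<in> V // R"
  shows "indicator W \<in> cfun V"
  using in_quotient_imp_subset[OF assms] by (auto simp: cfun_def indicator_def)

lemma blow_up_in_cfun: "blow_up V R y \<in> cfun V"
  by (simp add: cfun_def blow_up_def)

lemma blow_up_eq_sum_indicator:
  assumes fin: "finite V" and eq: "equiv V R"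
  shows "blow_up V R y = (\<lambda>v. \<Sum>W\<in>V // R. y W * indicator W v)"
proof
  fix v
  show "blow_up V R y v = (\<Sum>W\<in>V // R. y W * indicator W v)"
  proof (cases "v \<in> V")
    case True
    then show ?thesis by (simp add: blow_up_def class_indicator_expansion[OF fin eq])
  next
    case False
    then have "v \<notin> W" if "W \<in> V // R" for W
      using in_quotient_imp_subset[OF eq that] by auto
    then show ?thesis using False by (simp add: blow_up_def)
  qed
qed

text \<open>By linearity this only has to be checked on the characteristic functions of classes, where
  it is the defining property of the contraction coefficients; compatibility enters through the
  existence of such coefficients.\<close>

lemma compatible_blow_up:
  assumes fin: "finite V" and eq: "equiv V R" and T: "compatible V R T"
  shows "T (blow_up V R y) = blow_up V R (contraction V R T y)"
proof
  fix v
  have lin: "linear_operator V T" using T by (simp add: compatible_def)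
  let ?c = "contraction_coeff V R T"
  have c: "is_contraction_coeff V R T ?c"
    unfolding contraction_coeff_def by (rule someI_ex[OF contraction_coeff_exists[OF fin eq T]])
  show "T (blow_up V R y) v = blow_up V R (contraction V R T y) v"
  proof (cases "v \<in> V")
    case True
    have finQ: "finite (V // R)"
      using fin eq by (simp add: finite_quotient equiv_type)
    have "T (blow_up V R y) v = (\<Sum>W\<in>V // R. y W * T (indicator W) v)"
      by (simp add: blow_up_eq_sum_indicator[OF fin eq]
          linear_operator_sum[OF lin finQ indicator_class_in_cfun[OF eq]])
    also have "\<dots> = (\<Sum>W\<in>V // R. y W * ?c W (R `` {v}))"
      using c by (intro sum.cong)
        (simp_all add: is_contraction_coeff_def class_indicator_expansion[OF fin eq True])
    also have "\<dots> = blow_up V R (contraction V R T y) v"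
      using True by (simp add: blow_up_def contraction_def quotientI mult.commute)
    finally show ?thesis .
  next
    case False
    have "T (blow_up V R y) \<in> cfun V"
      using lin blow_up_in_cfun unfolding linear_operator_def by blast
    then show ?thesis using False by (simp add: cfun_def blow_up_def)
  qed
qed

lemma blow_up_nonzero:
  assumes "y \<in> cfun (V // R)" and "y \<noteq> (\<lambda>_. 0)"
  shows "blow_up V R y \<noteq> (\<lambda>_. 0)"
proof -
  obtain U where U: "y U \<noteq> 0" using assms(2) by auto
  then have "U \<in> V // R" using assms(1) by (auto simp: cfun_def)
  then obtain v where "v \<in> V" "U = R `` {v}" by (rule quotientE)
  then have "blow_up V R y v \<noteq> 0" using U by (simp add: blow_up_def)
  then show ?thesis by auto
qed

theorem theorem2p10:
  fixes H :: "'v hypergraph" and R :: "'v rel"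
    and T :: "('v \<Rightarrow> complex) \<Rightarrow> ('v \<Rightarrow> complex)"
    and \<mu> :: complex and y :: "'v set \<Rightarrow> complex"
  assumes "finite_hypergraph H"
    and "equiv (verts H) R"
    and "compatible (verts H) R T"
    and "eigenvector (verts H // R) (contraction (verts H) R T) \<mu> y"
  shows "eigenvalue (verts H) T \<mu> \<and> eigenvector (verts H) T \<mu> (blow_up (verts H) R y)"
proof -
  have fin: "finite (verts H)" using assms(1) by (simp add: finite_hypergraph_def)
  have y: "y \<in> cfun (verts H // R)" "y \<noteq> (\<lambda>_. 0)"
    and ev: "contraction (verts H) R T y = (\<lambda>U. \<mu> * y U)"
    using assms(4) by (auto simp: eigenvector_def)
  have "T (blow_up (verts H) R y) = (\<lambda>v. \<mu> * blow_up (verts H) R y v)"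
    unfolding compatible_blow_up[OF fin assms(2,3)] ev by (auto simp: blow_up_def)
  then have "eigenvector (verts H) T \<mu> (blow_up (verts H) R y)"
    by (simp add: eigenvector_def blow_up_in_cfun blow_up_nonzero[OF y])
  then show ?thesis by (auto simp: eigenvalue_def)
qed

end
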